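(* Let $\mathscr W$ be a compound class of channels, $R$ a rate, and $\alpha,\beta:\mathscr W\to\mathbb R$ two functionals. For each $p_X$, the supremum over $F$ in $$\Delta_\beta E_\emptyset^L(R,\mathscr W,\alpha)=\max_{p_X}\sup_{F\in\mathcal F^L(R,p_X,\mathscr W,\alpha)}\Delta_\beta E_{r,|F^{-1}|^+}(R,p_X,\mathscr W)$$ is achieved by $$F^{L*}(t)=F_{R,p_X,\mathscr W,\alpha}(t)-\Delta_\alpha E_{sp}(R,p_X,\mathscr W)=-\Delta_\alpha E_{sp}(R+t,p_X,\mathscr W),$$ independently of the choice of $\beta$. The relative minimax is given by $$\Delta_\beta E_\emptyset^L(R,\mathscr W,\alpha)=\max_{p_X}\Delta_\beta E_{r,|(F^{L*})^{-1}|^+}(R,p_X,\mathscr W).$$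
   Context: $\mathcal X,\mathcal Y$ are finite alphabets; logarithms are base 2; $|t|^+=\max(0,t)$; $H(p_X)$ is entropy; $0<R\le H(p_X)$. A channel is a conditional p.m.f. $p_{Y|X}$ from $\mathcal X$ to $\mathcal Y$. $\mathscr W$ is a nonempty connected set of channels for which the minima over $\mathscr W$ below are attained. $I(p_X,\tilde p_{Y|X})$ is the mutual information under input $p_X$ and channel $\tilde p_{Y|X}$, and $D(\tilde p_{Y|X}\|p_{Y|X}|p_X)=\sum_x p_X(x) D(\tilde p_{Y|X}(\cdot|x)\|p_{Y|X}(\cdot|x))$. $E_{sp}(R,p_X,p_{Y|X})=\min_{\tilde p_{Y|X}: I(p_X,\tilde p_{Y|X})\le R} D(\tilde p_{Y|X}\|p_{Y|X}|p_X)$ ($+\infty$ if the set is empty). For a nondecreasing function $F$ on $[-R,H(p_X)-R]$, $E_{r,F}(R,p_X,p_{Y|X})=\min_{\tilde p_{Y|X}}[D(\tilde p_{Y|X}\|p_{Y|X}|p_X)+F(I(p_X,\tilde p_{Y|X})-R)]$ (terms with $D=+\infty$ are counted as $+\infty$ even if $F=-\infty$ there). The inverse of a nondecreasing $F$ is $F^{-1}(u)=\inf\{t\in[-R,H(p_X)-R]:F(t)\ge u\}$, $\inf\emptyset=+\infty$ (the ordinary inverse on the range when $F$ is continuous and strictly increasing), and $E_{r,|F^{-1}|^+}$ is $E_{r,G}$ with $G(u)=|F^{-1}(u)|^+$. Relative quantities, for a functional $\gamma:\mathscr W\to\mathbb R$ ($\gamma=\alpha$ or $\beta$): $\Delta_\gamma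 E_{r,F}(R,p_X,\mathscr W)=\min_{p_{Y|X}\in\mathscr W}[E_{r,F}(R,p_X,p_{Y|X})-\gamma(p_{Y|X})]$, $\Delta_\gamma E_{sp}(R,p_X,\mathscr W)=\min_{p_{Y|X}\in\mathscr W}[E_{sp}(R,p_X,p_{Y|X})-\gamma(p_{Y|X})]$, $F_{R,p_X,\mathscr W,\alpha}(t)=\Delta_\alpha E_{sp}(R,p_X,\mathscr W)-\Delta_\alpha E_{sp}(R+t,p_X,\mathscr W)$ (with $\Delta_\alpha E_{sp}(R,p_X,\mathscr W)<\infty$). $\mathcal F^L(R,p_X,\mathscr W,\alpha)$ is the set of continuous, strictly increasing $F:[-R,H(p_X)-R]\to\mathbb R$ with $\Delta_\alpha E_{r,F}(R,p_X,\mathscr W)\ge0$. "$F^{L*}$ achieves the supremum" means that the supremum over $F$ equals $\Delta_\beta E_{r,|(F^{L*})^{-1}|^+}(R,p_X,\mathscr W)$ ($F^{L*}$ may be flat or $-\infty$ in places and is then a limit of admissible functions). *)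

theory Defs
  imports "HOL-Probability.Probability"
begin

section \<open>Information quantities on finite alphabets (logarithms to base 2)\<close>

type_synonym ('x, 'y) channel = "'x \<Rightarrow> 'y pmf"

definition pmf_entropy :: "'x::finite pmf \<Rightarrow> real" where
  "pmf_entropy p = prob_space.entropy (measure_pmf p) 2 (count_space UNIV) (\<lambda>x. x)"

definition joint_pmf :: "'x pmf \<Rightarrow> ('x, 'y) channel \<Rightarrow> ('x \<times> 'y) pmf" where
  "joint_pmf p V = bind_pmf p (\<lambda>x. map_pmf (Pair x) (V x))"

definition chan_mutual_info :: "'x::finite pmf \<Rightarrow> ('x, 'y::finite) channel \<Rightarrow> real" where
  "chan_mutual_info p V =
     prob_space.mutual_information (measure_pmf (joint_pmf p V)) 2
       (count_space UNIV) (count_space UNIV) fst snd"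

text \<open>The library's \<open>KL_divergence b M N\<close> is the divergence of \<open>N\<close> from \<open>M\<close>, is real-valued, and is
  only meaningful when \<open>N\<close> is absolutely continuous with respect to \<open>M\<close>.\<close>

definition pmf_divergence :: "'y::finite pmf \<Rightarrow> 'y pmf \<Rightarrow> ereal" where
  "pmf_divergence P Q =
     (if set_pmf P \<subseteq> set_pmf Q then ereal (KL_divergence 2 (measure_pmf Q) (measure_pmf P)) else \<infinity>)"

text \<open>Since \<open>0 * \<infinity> = 0\<close> in \<open>ereal\<close>, inputs of probability zero do not contribute.\<close>

definition cond_divergence ::
  "('x::finite, 'y::finite) channel \<Rightarrow> ('x, 'y) channel \<Rightarrow> 'x pmf \<Rightarrow> ereal" where
  "cond_divergence V W p = (\<Sum>x\<in>UNIV. ereal (pmf p x) * pmf_divergence (V x) (W x))"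

text \<open>Channels carry the Euclidean topology of their transition matrices.\<close>

definition channel_matrix :: "('x, 'y) channel \<Rightarrow> 'x \<Rightarrow> 'y \<Rightarrow> real" where
  "channel_matrix W x y = pmf (W x) y"

definition inputs :: "real \<Rightarrow> 'x::finite pmf set" where
  "inputs R = {p. R \<le> pmf_entropy p}"

subsection \<open>The textbook formulas\<close>

lemma KL_divergence_pmf:
  fixes P Q :: "'y::finite pmf"
  assumes "set_pmf P \<subseteq> set_pmf Q"
  shows "KL_divergence 2 (measure_pmf Q) (measure_pmf P) =
           (\<Sum>y\<in>UNIV. pmf P y * log 2 (pmf P y / pmf Q y))"
proof -
  have "measure_pmf P = density (measure_pmf Q) (\<lambda>y. ennreal (pmf P y / pmf Q y))"
  proof (rule measure_eqI_finite[where A=UNIV])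
    fix y :: 'y
    have "pmf P y = pmf P y / pmf Q y * pmf Q y"
      using assms by (auto simp: set_pmf_iff)
    then have "ennreal (pmf P y) = ennreal (pmf P y / pmf Q y) * ennreal (pmf Q y)"
      by (metis ennreal_mult divide_nonneg_nonneg pmf_nonneg)
    then show "emeasure (measure_pmf P) {y} =
        emeasure (density (measure_pmf Q) (\<lambda>y. ennreal (pmf P y / pmf Q y))) {y}"
      by (simp add: emeasure_density nn_integral_indicator_singleton emeasure_pmf_single)
  qed simp_all
  then have "KL_divergence 2 (measure_pmf Q) (measure_pmf P) =
      (\<integral>y. pmf P y / pmf Q y * log 2 (pmf P y / pmf Q y) \<partial>measure_pmf Q)"
    using sigma_finite_measure.KL_density[OF prob_space_imp_sigma_finite[OF prob_space_measure_pmf], of 2 "\<lambda>y. pmf P y / pmf Q y" Q] by simp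
  also have "\<dots> = (\<Sum>y\<in>UNIV. pmf P y * log 2 (pmf P y / pmf Q y))"
    using assms by (auto simp: integral_measure_pmf_real[of UNIV] set_pmf_iff intro!: sum.cong)
  finally show ?thesis .
qed

lemma pmf_entropy_eq: "pmf_entropy p = - (\<Sum>x\<in>UNIV. pmf p x * log 2 (pmf p x))"
proof -
  have "KL_divergence 2 (count_space UNIV) (measure_pmf p) = (\<Sum>x\<in>UNIV. pmf p x * log 2 (pmf p x))"
    using sigma_finite_measure.KL_density[OF sigma_finite_measure_count_space_finite, of UNIV 2 "pmf p"]
    by (simp add: measure_pmf_eq_density[of p] lebesgue_integral_count_space_finite)
  then show ?thesis
    by (simp add: pmf_entropy_def prob_space.entropy_def[OF prob_space_measure_pmf] distr_id2)
qed

lemma pmf_joint_pmf: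
  fixes p :: "'x::finite pmf" 
  shows "pmf (joint_pmf p V) (x, y) = pmf p x * pmf (V x) y"
proof -
  have "pmf (map_pmf (Pair z) (V z)) (x, y) = (if z = x then pmf (V x) y else 0)" for z
    by (cases "z = x") (auto simp: pmf_map_inj' inj_on_def set_pmf_iff[symmetric] pmf_eq_0_set_pmf)
  then have "pmf (joint_pmf p V) (x, y) = (\<Sum>z\<in>UNIV. (if z = x then pmf (V x) y else 0) * pmf p z)"
    by (simp only: joint_pmf_def pmf_bind integral_measure_pmf_real[of UNIV] finite UNIV_I)
  then show ?thesis
    by (simp add: if_distrib[of "\<lambda>u. u * _"] cong: if_cong)
qed

lemma chan_mutual_info_eq:
  fixes p :: "'x::finite pmf" and V :: "('x, 'y::finite) channel"
  shows "chan_mutual_info p V =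
     (\<Sum>x\<in>UNIV. \<Sum>y\<in>UNIV. pmf p x * pmf (V x) y *
        log 2 (pmf (V x) y / (\<Sum>x'\<in>UNIV. pmf p x' * pmf (V x') y)))"
proof -
  let ?J = "joint_pmf p V" 
  let ?Q = "bind_pmf p V"
  have fst: "map_pmf fst ?J = p"
    by (simp add: joint_pmf_def map_bind_pmf pmf.map_comp o_def map_pmf_const bind_return_pmf')
  have snd: "map_pmf snd ?J = ?Q"
    by (simp add: joint_pmf_def map_bind_pmf pmf.map_comp o_def pmf.map_ident)
  have Q: "pmf ?Q y = (\<Sum>x'\<in>UNIV. pmf p x' * pmf (V x') y)" for y
    by (simp add: pmf_bind integral_measure_pmf_real[of UNIV] mult.commute)
  have f: "distr (measure_pmf ?J) (count_space UNIV) fst = measure_pmf p"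
    using fst by (metis map_pmf_rep_eq)
  have s: "distr (measure_pmf ?J) (count_space UNIV) snd = measure_pmf ?Q"
    using snd by (metis map_pmf_rep_eq)
  have cs: "count_space (UNIV::'x set) \<Otimes>\<^sub>M count_space (UNIV::'y set) = count_space UNIV"
    by (simp add: pair_measure_count_space)
  have pr: "measure_pmf p \<Otimes>\<^sub>M measure_pmf ?Q = measure_pmf (pair_pmf p ?Q)"
  proof (rule measure_eqI_finite[where A=UNIV])
    show "sets (measure_pmf p \<Otimes>\<^sub>M measure_pmf ?Q) = Pow UNIV"
      by (subst sets_pair_measure_cong[OF sets_measure_pmf_count_space sets_measure_pmf_count_space])
         (simp only: cs sets_count_space)
    fix z :: "'x \<times> 'y"
    obtain x y where z: "z = (x, y)" by (cases z)
    have "{z} = {x} \<times> {y}"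
      using z by auto
    then have "emeasure (measure_pmf p \<Otimes>\<^sub>M measure_pmf ?Q) {z} = ennreal (pmf p x) * ennreal (pmf ?Q y)"
      by (simp only:) (subst measure_pmf.emeasure_pair_measure_Times, simp_all add: emeasure_pmf_single)
    also have "\<dots> = emeasure (measure_pmf (pair_pmf p ?Q)) {z}"
      by (simp only: z emeasure_pmf_single pmf_pair ennreal_mult pmf_nonneg)
    finally show "emeasure (measure_pmf p \<Otimes>\<^sub>M measure_pmf ?Q) {z} = emeasure (measure_pmf (pair_pmf p ?Q)) {z}" .
  qed simp_all
  have sub: "set_pmf ?J \<subseteq> set_pmf (pair_pmf p ?Q)"
    by (auto simp: joint_pmf_def)
  have "chan_mutual_info p V = KL_divergence 2 (measure_pmf (pair_pmf p ?Q)) (measure_pmf ?J)"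
    unfolding chan_mutual_info_def prob_space.mutual_information_def[OF prob_space_measure_pmf] f s cs pr
    by (simp add: distr_id2)
  also have "\<dots> = (\<Sum>z\<in>UNIV. pmf ?J z * log 2 (pmf ?J z / pmf (pair_pmf p ?Q) z))"
    by (rule KL_divergence_pmf[OF sub])
  also have "\<dots> = (\<Sum>x\<in>UNIV. \<Sum>y\<in>UNIV. pmf ?J (x, y) * log 2 (pmf ?J (x, y) / pmf (pair_pmf p ?Q) (x, y)))"
    by (simp add: sum.cartesian_product flip: UNIV_Times_UNIV)
  also have "\<dots> = (\<Sum>x\<in>UNIV. \<Sum>y\<in>UNIV. pmf p x * pmf (V x) y * log 2 (pmf (V x) y / pmf ?Q y))"
    by (intro sum.cong refl) (auto simp: pmf_joint_pmf pmf_pair)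
  finally show ?thesis by (simp add: Q)
qed

section \<open>Error exponents\<close>

text \<open>Minima are written as infima in \<open>ereal\<close>, so that the minimum over the empty set is \<open>\<infinity>\<close>.
  The attainment of the minima over a class of channels is the separate condition
  \<open>minima_attained\<close> below.\<close>

definition E_sp :: "real \<Rightarrow> 'x::finite pmf \<Rightarrow> ('x, 'y::finite) channel \<Rightarrow> ereal" where
  "E_sp R p W = (INF V\<in>{V. chan_mutual_info p V \<le> R}. cond_divergence V W p)"

text \<open>In \<open>ereal\<close> one has \<open>\<infinity> + (-\<infinity>) = \<infinity>\<close>, so terms with infinite divergence count as \<open>\<infinity>\<close> for every
  value of \<open>F\<close>. Only the values of \<open>F\<close> on the interval from \<open>-R\<close> to \<open>pmf_entropy p - R\<close> matter.\<close>

definition E_r :: "(real \<Rightarrow> ereal) \<Rightarrow> real \<Rightarrow> 'x::finite pmf \<Rightarrow> ('x, 'y::finite) channel \<Rightarrow> ereal" where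
  "E_r F R p W = (INF V. cond_divergence V W p + F (chan_mutual_info p V - R))"

definition mono_inverse :: "real \<Rightarrow> 'x::finite pmf \<Rightarrow> (real \<Rightarrow> ereal) \<Rightarrow> real \<Rightarrow> ereal" where
  "mono_inverse R p F u = Inf (ereal ` {t \<in> {-R..pmf_entropy p - R}. ereal u \<le> F t})"

definition pos_inverse :: "real \<Rightarrow> 'x::finite pmf \<Rightarrow> (real \<Rightarrow> ereal) \<Rightarrow> real \<Rightarrow> ereal" where
  "pos_inverse R p F u = max 0 (mono_inverse R p F u)"


section \<open>Relative quantities\<close>

definition rel_min ::
  "(('x, 'y) channel \<Rightarrow> real) \<Rightarrow> (('x, 'y) channel \<Rightarrow> ereal) \<Rightarrow> ('x, 'y) channel set \<Rightarrow> ereal" where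
  "rel_min \<gamma> E \<W> = (INF W\<in>\<W>. E W - ereal (\<gamma> W))"

definition rel_min_attained ::
  "(('x, 'y) channel \<Rightarrow> real) \<Rightarrow> (('x, 'y) channel \<Rightarrow> ereal) \<Rightarrow> ('x, 'y) channel set \<Rightarrow> bool" where
  "rel_min_attained \<gamma> E \<W> \<longleftrightarrow> (\<exists>W\<in>\<W>. E W - ereal (\<gamma> W) = rel_min \<gamma> E \<W>)"

definition Delta_E_r ::
  "(('x::finite, 'y::finite) channel \<Rightarrow> real) \<Rightarrow> (real \<Rightarrow> ereal) \<Rightarrow> real \<Rightarrow> 'x pmf \<Rightarrow>
   ('x, 'y) channel set \<Rightarrow> ereal" where
  "Delta_E_r \<gamma> F R p \<W> = rel_min \<gamma> (E_r F R p) \<W>"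

definition Delta_E_sp ::
  "(('x::finite, 'y::finite) channel \<Rightarrow> real) \<Rightarrow> real \<Rightarrow> 'x pmf \<Rightarrow> ('x, 'y) channel set \<Rightarrow> ereal" where
  "Delta_E_sp \<gamma> R p \<W> = rel_min \<gamma> (E_sp R p) \<W>"

definition F_rel ::
  "real \<Rightarrow> 'x::finite pmf \<Rightarrow> ('x, 'y::finite) channel set \<Rightarrow> (('x, 'y) channel \<Rightarrow> real) \<Rightarrow>
   real \<Rightarrow> ereal" where
  "F_rel R p \<W> \<alpha> t = Delta_E_sp \<alpha> R p \<W> - Delta_E_sp \<alpha> (R + t) p \<W>"

definition F_L_star ::
  "real \<Rightarrow> 'x::finite pmf \<Rightarrow> ('x, 'y::finite) channel set \<Rightarrow> (('x, 'y) channel \<Rightarrow> real) \<Rightarrow>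
   real \<Rightarrow> ereal" where
  "F_L_star R p \<W> \<alpha> t = - Delta_E_sp \<alpha> (R + t) p \<W>"

definition cont_strict_mono :: "real \<Rightarrow> 'x::finite pmf \<Rightarrow> (real \<Rightarrow> real) set" where
  "cont_strict_mono R p =
     {F. continuous_on {-R..pmf_entropy p - R} F \<and> strict_mono_on {-R..pmf_entropy p - R} F}"

definition F_L ::
  "real \<Rightarrow> 'x::finite pmf \<Rightarrow> ('x, 'y::finite) channel set \<Rightarrow> (('x, 'y) channel \<Rightarrow> real) \<Rightarrow>
   (real \<Rightarrow> real) set" where
  "F_L R p \<W> \<alpha> = {F \<in> cont_strict_mono R p. 0 \<le> Delta_E_r \<alpha> (\<lambda>t. ereal (F t)) R p \<W>}"

definition sup_F_L ::
  "real \<Rightarrow> 'x::finite pmf \<Rightarrow> ('x, 'y::finite) channel set \<Rightarrow> (('x, 'y) channel \<Rightarrow> real) \<Rightarrow>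
   (('x, 'y) channel \<Rightarrow> real) \<Rightarrow> ereal" where
  "sup_F_L R p \<W> \<alpha> \<beta> =
     (SUP F\<in>F_L R p \<W> \<alpha>. Delta_E_r \<beta> (pos_inverse R p (\<lambda>t. ereal (F t))) R p \<W>)"

text \<open>The maximum over the input distributions is written as a supremum in \<open>ereal\<close>.\<close>

definition rel_minimax ::
  "real \<Rightarrow> ('x::finite, 'y::finite) channel set \<Rightarrow> (('x, 'y) channel \<Rightarrow> real) \<Rightarrow>
   (('x, 'y) channel \<Rightarrow> real) \<Rightarrow> ereal" where
  "rel_minimax R \<W> \<alpha> \<beta> = (SUP p\<in>inputs R. sup_F_L R p \<W> \<alpha> \<beta>)"

text \<open>The standing assumption that all the minima over \<open>\<W>\<close> are attained: those defining
  \<open>F_L_star\<close>, those deciding membership in \<open>F_L\<close>, and those in the relative minimax and in its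
  evaluation. A minimum with the value \<open>\<infinity>\<close> counts as attained.\<close>

definition minima_attained ::
  "real \<Rightarrow> ('x::finite, 'y::finite) channel set \<Rightarrow> (('x, 'y) channel \<Rightarrow> real) \<Rightarrow>
   (('x, 'y) channel \<Rightarrow> real) \<Rightarrow> bool" where
  "minima_attained R \<W> \<alpha> \<beta> \<longleftrightarrow>
     (\<forall>p\<in>inputs R.
        (\<forall>t\<in>{-R..pmf_entropy p - R}. rel_min_attained \<alpha> (E_sp (R + t) p) \<W>) \<and>
        (\<forall>F\<in>cont_strict_mono R p. rel_min_attained \<alpha> (E_r (\<lambda>t. ereal (F t)) R p) \<W>) \<and>
        (\<forall>F\<in>F_L R p \<W> \<alpha>.
           rel_min_attained \<beta> (E_r (pos_inverse R p (\<lambda>t. ereal (F t))) R p) \<W>) \<and>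
        rel_min_attained \<beta> (E_r (pos_inverse R p (F_L_star R p \<W> \<alpha>)) R p) \<W>)"

end

theory Submission
  imports Defs "HOL-Real_Asymp.Real_Asymp"
begin

text \<open>An increasing \<open>F\<close> is admissible exactly when it lies above \<open>F_L_star\<close>, so its inverse lies
  below that of \<open>F_L_star\<close> and the supremum is at most the claimed value. Conversely, sup-convolution
  with a steep ramp, plus a small slope, gives admissible \<open>F\<close> whose inverses approximate that of
  \<open>F_L_star\<close> from below up to small shifts. As \<open>\<W>\<close> need not be closed, the infimum over \<open>\<W>\<close> is
  interchanged with this limit as follows: attainment of the minima forces \<open>\<beta>\<close> to be bounded above,
  hence the divergences \<open>D(V|W)\<close> of near-optimal pairs are bounded. If \<open>V\<close> tends to \<open>V0\<close> along such
  pairs, replacing \<open>V\<close> by \<open>V0\<close> while keeping \<open>W\<close> costs arbitrarily little, and the inverse of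
  \<open>F_L_star\<close> is left-continuous.\<close>

section \<open>The function t log t and a tangent bound\<close>

lemma continuous_on_x_log_x: "continuous_on {0..} (\<lambda>t::real. t * log 2 t)"
proof -
  have "continuous (at t within {0..}) (\<lambda>t::real. t * log 2 t)" if "0 \<le> t" for t
  proof (cases "t = 0")
    case True
    have "((\<lambda>t::real. t * log 2 t) \<longlongrightarrow> 0) (at_right 0)"
      by real_asymp
    moreover have "at (0::real) within {0..} = at_right 0"
      by (metis at_within_Ici_at_right)
    ultimately show ?thesis
      using True by (simp add: continuous_within)
  next
    case False
    with that show ?thesis by (intro continuous_intros) auto
  qed
  then show ?thesis by (simp add: continuous_on_eq_continuous_within)
qed

lemma tendsto_x_log_x:
  fixes f :: "nat \<Rightarrow> real"
  assumes "f \<longlonglongrightarrow> l" and "\<And>n. 0 \<le> f n"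
  shows "(\<lambda>n. f n * log 2 (f n)) \<longlonglongrightarrow> l * log 2 l"
proof -
  have "0 \<le> l" using assms by (meson LIMSEQ_le_const)
  then show ?thesis
    using continuous_on_tendsto_compose[OF continuous_on_x_log_x assms(1)] assms(2) by simp
qed

text \<open>The bound \<open>ln x\<close> \<le> \<open>x - 1\<close> at \<open>x = b / a\<close>.
  Summed over two distributions the left sides cancel, which is Gibbs' inequality.\<close>

lemma log2_ratio_ge:
  fixes a b :: real
  assumes "0 \<le> a" "0 \<le> b" "b = 0 \<Longrightarrow> a = 0"
  shows "(a - b) / ln 2 \<le> a * log 2 (a / b)"
proof (cases "a = 0")
  case True
  then show ?thesis using assms by (simp add: divide_simps)
next
  case False
  then have ab: "0 < a" "0 < b" using assms by force+
  have "ln (b / a) \<le> b / a - 1"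
    using ab by (intro ln_le_minus_one) simp
  then have "1 - b / a \<le> ln (a / b)"
    using ab by (simp add: ln_div)
  then have "a * (1 - b / a) \<le> a * ln (a / b)"
    using ab by (intro mult_left_mono) auto
  moreover have "a * (1 - b / a) = a - b"
    using ab by (simp add: right_diff_distrib)
  ultimately have "a - b \<le> a * ln (a / b)"
    by simp
  then show ?thesis
    by (simp add: log_def divide_right_mono)
qed

lemma x_log_x_ge: "- 1 / ln 2 \<le> (t::real) * log 2 t" if "0 \<le> t"
proof -
  have "(t - 1) / ln 2 \<le> t * log 2 (t / 1)"
    using that by (intro log2_ratio_ge) auto
  moreover have "- 1 / ln 2 \<le> (t - 1) / ln (2::real)"
    using that by (intro divide_right_mono) auto
  ultimately show ?thesis by simp
qed

section \<open>Divergence and mutual information\<close>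

lemma sum_pmf_UNIV: "(\<Sum>y\<in>UNIV. pmf P y) = 1" for P :: "'y::finite pmf"
  by (rule sum_pmf_eq_1) auto

text \<open>Splitting the logarithm isolates \<open>t * log 2 t\<close>, which is continuous also at
  0, so that only the cross term needs care in limits.\<close>

lemma pmf_divergence_eq:
  fixes P Q :: "'y::finite pmf"
  assumes "set_pmf P \<subseteq> set_pmf Q"
  shows "pmf_divergence P Q =
    ereal (\<Sum>y\<in>UNIV. pmf P y * log 2 (pmf P y) - pmf P y * log 2 (pmf Q y))"
proof -
  have "pmf P y * log 2 (pmf P y / pmf Q y) = pmf P y * log 2 (pmf P y) - pmf P y * log 2 (pmf Q y)"
    for y
  proof (cases "pmf P y = 0")
    case False
    then have "pmf Q y \<noteq> 0" using assms by (auto simp: set_pmf_iff)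
    then have "0 < pmf P y" "0 < pmf Q y" using False by (auto simp: less_le)
    then show ?thesis by (simp add: log_divide algebra_simps)
  qed simp
  then show ?thesis
    using assms by (simp add: pmf_divergence_def KL_divergence_pmf)
qed

lemma pmf_divergence_nonneg: "0 \<le> pmf_divergence P Q" for P Q :: "'y::finite pmf"
proof (cases "set_pmf P \<subseteq> set_pmf Q")
  case True
  have "0 = (\<Sum>y\<in>UNIV. (pmf P y - pmf Q y) / ln 2)"
    by (simp add: sum_subtractf sum_pmf_UNIV flip: sum_divide_distrib)
  also have "\<dots> \<le> (\<Sum>y\<in>UNIV. pmf P y * log 2 (pmf P y / pmf Q y))"
    using True by (intro sum_mono log2_ratio_ge) (auto simp: set_pmf_iff)
  finally show ?thesis
    using True by (simp add: pmf_divergence_def KL_divergence_pmf)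
qed (simp add: pmf_divergence_def)

lemma cond_divergence_nonneg: "0 \<le> cond_divergence V W p"
  unfolding cond_divergence_def
  by (intro sum_nonneg ereal_0_le_mult) (auto simp: pmf_divergence_nonneg)

lemma cond_divergence_self: "cond_divergence W W p = 0"
  by (simp add: cond_divergence_def pmf_divergence_eq zero_ereal_def[symmetric])

text \<open>Mutual information is the average over \<open>p\<close> of the divergence of
  \<open>V x\<close> from the output law \<open>q\<close>, so Gibbs' inequality applies for each
  input.\<close>

lemma chan_mutual_info_nonneg: "0 \<le> chan_mutual_info p V"
  for p :: "'x::finite pmf" and V :: "('x, 'y::finite) channel"
proof -
  define q where "q y = (\<Sum>x\<in>UNIV. pmf p x * pmf (V x) y)" for y
  have q0: "0 \<le> q y" for y
    unfolding q_def by (intro sum_nonneg) auto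
  have q1: "pmf p x * pmf (V x) y \<le> q y" for x y
    unfolding q_def by (intro member_le_sum) auto
  have qs: "(\<Sum>y\<in>UNIV. q y) = 1"
    unfolding q_def by (subst sum.swap) (simp add: sum_pmf_UNIV flip: sum_distrib_left)
  have "0 = (\<Sum>x\<in>UNIV. \<Sum>y\<in>UNIV. pmf p x * ((pmf (V x) y - q y) / ln 2))"
    by (simp add: sum_subtractf sum_pmf_UNIV qs flip: sum_divide_distrib sum_distrib_left)
  also have "\<dots> \<le> (\<Sum>x\<in>UNIV. \<Sum>y\<in>UNIV. pmf p x * (pmf (V x) y * log 2 (pmf (V x) y / q y)))"
  proof (intro sum_mono)
    fix x y
    show "pmf p x * ((pmf (V x) y - q y) / ln 2) \<le> pmf p x * (pmf (V x) y * log 2 (pmf (V x) y / q y))"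
    proof (cases "pmf p x = 0")
      case False
      \<comment> \<open>Absolute continuity with respect to \<open>q\<close> holds for inputs of
        positive probability, hence the case split.\<close>
      have "pmf (V x) y = 0" if "q y = 0"
        using q1[of x y] that False by (simp add: mult_le_0_iff less_le)
      then show ?thesis
        by (intro mult_left_mono log2_ratio_ge q0) auto
    qed simp
  qed
  finally show ?thesis
    by (simp add: chan_mutual_info_eq q_def mult.assoc)
qed

text \<open>Since \<open>q y\<close> is at least \<open>pmf p x * pmf (V x) y\<close>, each
  likelihood ratio is at most \<open>1 / pmf p x\<close>; averaging its logarithm gives the
  entropy.\<close>

lemma chan_mutual_info_le_entropy: "chan_mutual_info p V \<le> pmf_entropy p"
  for p :: "'x::finite pmf" and V :: "('x, 'y::finite) channel"
proof -
  define q where "q y = (\<Sum>x\<in>UNIV. pmf p x * pmf (V x) y)" for y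
  have q1: "pmf p x * pmf (V x) y \<le> q y" for x y
    unfolding q_def by (intro member_le_sum) auto
  have "chan_mutual_info p V =
    (\<Sum>x\<in>UNIV. \<Sum>y\<in>UNIV. pmf p x * pmf (V x) y * log 2 (pmf (V x) y / q y))"
    by (simp add: chan_mutual_info_eq q_def)
  also have "\<dots> \<le> (\<Sum>x\<in>UNIV. \<Sum>y\<in>UNIV. pmf p x * pmf (V x) y * - log 2 (pmf p x))"
  proof (intro sum_mono)
    fix x y
    show "pmf p x * pmf (V x) y * log 2 (pmf (V x) y / q y)
      \<le> pmf p x * pmf (V x) y * - log 2 (pmf p x)"
    proof (cases "pmf p x * pmf (V x) y = 0")
      case False
      then have pos: "0 < pmf p x" "0 < pmf (V x) y" by (auto simp: less_le)
      then have "0 < q y" using q1[of x y] by (meson less_le_trans mult_pos_pos)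
      then have "pmf (V x) y / q y \<le> 1 / pmf p x"
        using q1[of x y] pos by (simp add: field_simps)
      then have "log 2 (pmf (V x) y / q y) \<le> log 2 (1 / pmf p x)"
        using pos \<open>0 < q y\<close> by (subst log_le_cancel_iff) auto
      also have "\<dots> = - log 2 (pmf p x)"
        using pos by (simp add: log_divide)
      finally show ?thesis by (intro mult_left_mono) auto
    qed auto
  qed
  also have "\<dots> = pmf_entropy p"
    by (simp add: pmf_entropy_eq sum_pmf_UNIV sum_negf flip: sum_distrib_left sum_distrib_right)
  finally show ?thesis .
qed

section \<open>Limits of channels\<close>

text \<open>Output entropy minus conditional entropy is a combination of terms
  \<open>t * log 2 t\<close>, continuous even where letters lose their mass in the limit.\<close>

lemma chan_mutual_info_tendsto:
  fixes p :: "'x::finite pmf" and V :: "nat \<Rightarrow> ('x, 'y::finite) channel"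
  assumes lim: "\<And>x y. (\<lambda>n. pmf (V n x) y) \<longlonglongrightarrow> pmf (V0 x) y"
  shows "(\<lambda>n. chan_mutual_info p (V n)) \<longlonglongrightarrow> chan_mutual_info p V0"
proof -
  define q where "q U y = (\<Sum>x\<in>UNIV. pmf p x * pmf (U x) y)" for U :: "('x, 'y) channel" and y
  have q0: "0 \<le> q U y" for U y
    unfolding q_def by (intro sum_nonneg) auto
  have q1: "pmf p x * pmf (U x) y \<le> q U y" for U x y
    unfolding q_def by (intro member_le_sum) auto
  have eq: "chan_mutual_info p U =
    (\<Sum>x\<in>UNIV. \<Sum>y\<in>UNIV. pmf p x * (pmf (U x) y * log 2 (pmf (U x) y))) -
    (\<Sum>y\<in>UNIV. q U y * log 2 (q U y))" for U :: "('x, 'y) channel"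
  proof -
    have "chan_mutual_info p U = (\<Sum>x\<in>UNIV. \<Sum>y\<in>UNIV.
        pmf p x * pmf (U x) y * log 2 (pmf (U x) y / q U y))"
      by (simp add: chan_mutual_info_eq q_def)
    also have "\<dots> = (\<Sum>x\<in>UNIV. \<Sum>y\<in>UNIV. pmf p x * (pmf (U x) y * log 2 (pmf (U x) y))
        - pmf p x * pmf (U x) y * log 2 (q U y))"
    proof (intro sum.cong refl)
      fix x y
      show "pmf p x * pmf (U x) y * log 2 (pmf (U x) y / q U y) =
        pmf p x * (pmf (U x) y * log 2 (pmf (U x) y)) - pmf p x * pmf (U x) y * log 2 (q U y)"
      proof (cases "pmf p x * pmf (U x) y = 0")
        case False
        then have pos: "0 < pmf p x" "0 < pmf (U x) y" by (auto simp: less_le)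
        then have "0 < q U y" using q1[of x U y] by (meson less_le_trans mult_pos_pos)
        then show ?thesis using pos by (simp add: log_divide algebra_simps)
      qed auto
    qed
    also have "\<dots> = (\<Sum>x\<in>UNIV. \<Sum>y\<in>UNIV. pmf p x * (pmf (U x) y * log 2 (pmf (U x) y))) -
        (\<Sum>y\<in>UNIV. \<Sum>x\<in>UNIV. pmf p x * pmf (U x) y * log 2 (q U y))"
      by (subst (3) sum.swap) (simp add: sum_subtractf)
    finally show ?thesis
      by (simp add: q_def flip: sum_distrib_right)
  qed
  have "(\<lambda>n. q (V n) y) \<longlonglongrightarrow> q V0 y" for y
    unfolding q_def by (intro tendsto_intros lim)
  then show ?thesis
    unfolding eq by (intro tendsto_intros tendsto_x_log_x lim q0) auto
qed

text \<open>Transition matrices lie in a compact box, and the conditions that make rows probability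
  vectors survive the limit.\<close>

lemma channel_convergent_subseq:
  fixes V :: "nat \<Rightarrow> ('x::finite, 'y::finite) channel"
  obtains r V0 where "strict_mono (r :: nat \<Rightarrow> nat)"
    "\<forall>x y. (\<lambda>n. pmf (V (r n) x) y) \<longlonglongrightarrow> pmf (V0 x) y"
proof -
  define v :: "nat \<Rightarrow> real ^ ('x \<times> 'y)" where "v n = (\<chi> z. pmf (V n (fst z)) (snd z))" for n
  have "v n \<in> cbox 0 1" for n
    by (simp add: v_def mem_box_cart pmf_le_1)
  then have "bounded (range v)"
    by (meson bounded_cbox bounded_subset image_subsetI)
  then obtain l r where r: "strict_mono (r :: nat \<Rightarrow> nat)" and l: "(v \<circ> r) \<longlonglongrightarrow> l"
    using bounded_imp_convergent_subsequence by blast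
  have lim: "(\<lambda>n. pmf (V (r n) x) y) \<longlonglongrightarrow> l $ (x, y)" for x y
    using tendsto_vec_nth[OF l, of "(x, y)"] by (simp add: v_def o_def)
  have nn: "0 \<le> l $ (x, y)" for x y
    using lim[of x y] by (rule LIMSEQ_le_const) auto
  have sum1: "(\<Sum>y\<in>UNIV. l $ (x, y)) = 1" for x
  proof (rule LIMSEQ_unique)
    show "(\<lambda>n. \<Sum>y\<in>UNIV. pmf (V (r n) x) y) \<longlonglongrightarrow> (\<Sum>y\<in>UNIV. l $ (x, y))"
      by (intro tendsto_intros lim)
  qed (simp add: sum_pmf_UNIV)
  have "pmf (embed_pmf (\<lambda>y. l $ (x, y))) y = l $ (x, y)" for x y
  proof (rule pmf_embed_pmf)
    show "(\<integral>\<^sup>+ y. ennreal (l $ (x, y)) \<partial>count_space UNIV) = 1"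
      by (simp add: nn_integral_count_space_finite sum_ennreal nn sum1)
  qed (rule nn)
  with r lim show ?thesis
    by (intro that[of r "\<lambda>x. embed_pmf (\<lambda>y. l $ (x, y))"]) auto
qed


text \<open>No lower bound on \<open>Q\<close> is available, so semicontinuity is obtained as an upper bound along
  the sequence: where \<open>Q n y\<close> tends to zero, the bounded divergence forces \<open>P0 y = 0\<close> and the
  term \<open>P n y * log 2 (Q n y)\<close> has the right sign.\<close>

lemma pmf_divergence_limit:
  fixes P Q :: "nat \<Rightarrow> 'y::finite pmf"
  assumes P: "\<And>y. (\<lambda>n. pmf (P n) y) \<longlonglongrightarrow> pmf P0 y"
    and Q: "\<And>y. (\<lambda>n. pmf (Q n) y) \<longlonglongrightarrow> pmf Q0 y"
    and B: "\<And>n. pmf_divergence (P n) (Q n) \<le> ereal B"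
    and "0 < \<epsilon>"
  shows "\<forall>\<^sub>F n in sequentially. pmf_divergence P0 (Q n) \<le> pmf_divergence (P n) (Q n) + ereal \<epsilon>"
proof -
  have sub: "set_pmf (P n) \<subseteq> set_pmf (Q n)" for n
    using B[of n] by (auto simp: pmf_divergence_def split: if_splits)
  define N where "N = real CARD('y)"
  have N: "0 < N" by (simp add: N_def)
  \<comment> \<open>\<open>C\<close> bounds every cross term: \<open>B\<close> bounds the
    divergence, and the entropy part costs at most \<open>1 / ln 2\<close> per letter.\<close>
  define C where "C = \<bar>B\<bar> + N / ln 2"
  have "0 \<le> C" using N by (simp add: C_def)
  have logQ: "log 2 (pmf (Q n) y) \<le> 0" for n y
    using pmf_le_1[of "Q n" y] pmf_nonneg[of "Q n" y]
    by (cases "pmf (Q n) y = 0") (auto simp: log_def divide_nonpos_pos less_le)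
  have bound: "pmf (P n) y * - log 2 (pmf (Q n) y) \<le> C" for n y
  proof -
    have "- N / ln 2 = (\<Sum>y\<in>(UNIV::'y set). - 1 / ln 2)"
      by (simp add: N_def)
    also have "\<dots> \<le> (\<Sum>y\<in>UNIV. pmf (P n) y * log 2 (pmf (P n) y))"
      by (intro sum_mono x_log_x_ge) auto
    finally have "- N / ln 2 \<le> (\<Sum>y\<in>UNIV. pmf (P n) y * log 2 (pmf (P n) y))" .
    moreover have "(\<Sum>y\<in>UNIV. pmf (P n) y * log 2 (pmf (P n) y) - pmf (P n) y * log 2 (pmf (Q n) y)) \<le> B"
      using B[of n] by (simp add: pmf_divergence_eq[OF sub])
    ultimately have "(\<Sum>y\<in>UNIV. pmf (P n) y * - log 2 (pmf (Q n) y)) \<le> C"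
      by (simp add: sum_subtractf sum_negf C_def)
    moreover have "pmf (P n) y * - log 2 (pmf (Q n) y) \<le> (\<Sum>y\<in>UNIV. pmf (P n) y * - log 2 (pmf (Q n) y))"
      using logQ by (intro member_le_sum mult_nonneg_nonneg) auto
    ultimately show ?thesis by linarith
  qed
  have P0: "pmf P0 y = 0" if "pmf Q0 y = 0" for y
  proof (rule ccontr)
    define a where "a = pmf P0 y / 2"
    assume "pmf P0 y \<noteq> 0"
    then have a: "0 < a" "a < pmf P0 y" by (auto simp: a_def less_le)
    have "\<forall>\<^sub>F n in sequentially. a < pmf (P n) y"
      using P a by (rule_tac order_tendstoD) auto
    \<comment> \<open>The threshold makes \<open>a * - log 2 (pmf (Q n) y)\<close> exceed
      \<open>C + 1\<close>, against the bound \<open>C\<close> on the cross term.\<close>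
    moreover have "\<forall>\<^sub>F n in sequentially. pmf (Q n) y < 2 powr - ((C + 1) / a)"
      using Q[of y] that by (rule_tac order_tendstoD) auto
    ultimately have "\<forall>\<^sub>F n in sequentially. a < pmf (P n) y \<and> pmf (Q n) y < 2 powr - ((C + 1) / a)"
      by (rule eventually_conj)
    then obtain n where n: "a < pmf (P n) y" "pmf (Q n) y < 2 powr - ((C + 1) / a)"
      by (auto simp: eventually_sequentially)
    then have "pmf (Q n) y \<noteq> 0"
      using sub[of n] a by (auto simp: set_pmf_iff subset_eq)
    then have "0 < pmf (Q n) y" by (simp add: less_le)
    then have "log 2 (pmf (Q n) y) < - ((C + 1) / a)"
      using n(2) by (simp add: log_less_iff)
    then have "a * ((C + 1) / a) < a * - log 2 (pmf (Q n) y)"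
      using a by (intro mult_strict_left_mono) auto
    also have "\<dots> \<le> pmf (P n) y * - log 2 (pmf (Q n) y)"
      using n logQ by (intro mult_right_mono) auto
    also have "\<dots> \<le> C" by (rule bound)
    finally show False using a by simp
  qed
  have termwise: "\<forall>\<^sub>F n in sequentially.
      pmf P0 y * log 2 (pmf P0 y) - pmf P0 y * log 2 (pmf (Q n) y)
      \<le> pmf (P n) y * log 2 (pmf (P n) y) - pmf (P n) y * log 2 (pmf (Q n) y) + \<epsilon> / N" for y
  proof (cases "pmf Q0 y = 0")
    case True
    have "(\<lambda>n. pmf (P n) y * log 2 (pmf (P n) y)) \<longlonglongrightarrow> 0"
      using tendsto_x_log_x[OF P, of y] P0[OF True] by simp
    moreover have "- (\<epsilon> / N) < 0" using \<open>0 < \<epsilon>\<close> N by simp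
    ultimately have "\<forall>\<^sub>F n in sequentially. - (\<epsilon> / N) < pmf (P n) y * log 2 (pmf (P n) y)"
      by (rule order_tendstoD)
    then show ?thesis
    proof eventually_elim
      case (elim n)
      have "pmf (P n) y * log 2 (pmf (Q n) y) \<le> 0"
        using logQ by (intro mult_nonneg_nonpos) auto
      with elim P0[OF True] show ?case by simp
    qed
  next
    case False
    have "(\<lambda>n. (pmf P0 y * log 2 (pmf P0 y) - pmf P0 y * log 2 (pmf (Q n) y))
       - (pmf (P n) y * log 2 (pmf (P n) y) - pmf (P n) y * log 2 (pmf (Q n) y)))
      \<longlonglongrightarrow> (pmf P0 y * log 2 (pmf P0 y) - pmf P0 y * log 2 (pmf Q0 y))
       - (pmf P0 y * log 2 (pmf P0 y) - pmf P0 y * log 2 (pmf Q0 y))"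
      using False by (intro tendsto_intros tendsto_x_log_x P Q) (auto simp: less_le)
    then have "\<forall>\<^sub>F n in sequentially. (pmf P0 y * log 2 (pmf P0 y) - pmf P0 y * log 2 (pmf (Q n) y))
       - (pmf (P n) y * log 2 (pmf (P n) y) - pmf (P n) y * log 2 (pmf (Q n) y)) < \<epsilon> / N"
      using \<open>0 < \<epsilon>\<close> N by (intro order_tendstoD(2)) (auto intro!: divide_pos_pos)
    then show ?thesis by eventually_elim linarith
  qed
  \<comment> \<open>Eventual inclusion of supports makes the divergence of \<open>P0\<close> from
    \<open>Q n\<close> finite, so that the sum formula applies to it.\<close>
  have "\<forall>\<^sub>F n in sequentially. y \<in> set_pmf P0 \<longrightarrow> y \<in> set_pmf (Q n)" for y
  proof (cases "y \<in> set_pmf P0")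
    case True
    then have "0 < pmf Q0 y" using P0[of y] by (auto simp: set_pmf_iff less_le)
    then have "\<forall>\<^sub>F n in sequentially. 0 < pmf (Q n) y"
      using Q order_tendstoD(1) by blast
    then show ?thesis by eventually_elim (auto simp: set_pmf_iff)
  qed simp
  then have "\<forall>\<^sub>F n in sequentially. \<forall>y. y \<in> set_pmf P0 \<longrightarrow> y \<in> set_pmf (Q n)"
    by (rule eventually_all_finite)
  moreover have "\<forall>\<^sub>F n in sequentially. \<forall>y.
      pmf P0 y * log 2 (pmf P0 y) - pmf P0 y * log 2 (pmf (Q n) y)
      \<le> pmf (P n) y * log 2 (pmf (P n) y) - pmf (P n) y * log 2 (pmf (Q n) y) + \<epsilon> / N"
    using termwise by (rule eventually_all_finite)
  ultimately show ?thesis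
  proof eventually_elim
    case (elim n)
    have "(\<Sum>y\<in>UNIV. pmf P0 y * log 2 (pmf P0 y) - pmf P0 y * log 2 (pmf (Q n) y))
      \<le> (\<Sum>y\<in>UNIV. pmf (P n) y * log 2 (pmf (P n) y) - pmf (P n) y * log 2 (pmf (Q n) y) + \<epsilon> / N)"
      using elim by (intro sum_mono) auto
    also have "\<dots> = (\<Sum>y\<in>UNIV. pmf (P n) y * log 2 (pmf (P n) y) - pmf (P n) y * log 2 (pmf (Q n) y)) + \<epsilon>"
      using N by (subst sum.distrib) (simp add: N_def)
    finally show ?case
      using elim(1) by (subst (1 2) pmf_divergence_eq) (auto simp: subset_eq intro: sub[THEN subsetD])
  qed
qed

text \<open>Dividing the total bound by \<open>pmf p x\<close> bounds the divergence at each input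
  of positive probability; the errors, weighted by \<open>p\<close>, add up to \<epsilon>.\<close>

lemma cond_divergence_limit:
  fixes V W :: "nat \<Rightarrow> ('x::finite, 'y::finite) channel"
  assumes V: "\<And>x y. (\<lambda>n. pmf (V n x) y) \<longlonglongrightarrow> pmf (V0 x) y"
    and W: "\<And>x y. (\<lambda>n. pmf (W n x) y) \<longlonglongrightarrow> pmf (W0 x) y"
    and B: "\<And>n. cond_divergence (V n) (W n) p \<le> ereal B"
    and "0 < \<epsilon>"
  shows "\<forall>\<^sub>F n in sequentially.
    cond_divergence V0 (W n) p \<le> cond_divergence (V n) (W n) p + ereal \<epsilon>"
proof -
  have "\<forall>\<^sub>F n in sequentially. ereal (pmf p x) * pmf_divergence (V0 x) (W n x)
    \<le> ereal (pmf p x) * pmf_divergence (V n x) (W n x) + ereal (pmf p x * \<epsilon>)" for x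
  proof (cases "pmf p x = 0")
    case True
    then show ?thesis by (simp add: zero_ereal_def[symmetric])
  next
    case False
    then have px: "0 < pmf p x" by (simp add: less_le)
    have "pmf_divergence (V n x) (W n x) \<le> ereal (B / pmf p x)" for n
    proof -
      have "ereal (pmf p x) * pmf_divergence (V n x) (W n x) \<le> cond_divergence (V n) (W n) p"
        using sum_mono2[of UNIV "{x}" "\<lambda>x. ereal (pmf p x) * pmf_divergence (V n x) (W n x)"]
        by (simp add: cond_divergence_def pmf_divergence_nonneg)
      also note B[of n]
      finally show ?thesis
        using px by (cases "pmf_divergence (V n x) (W n x)") (auto simp: field_simps)
    qed
    then have "\<forall>\<^sub>F n in sequentially. pmf_divergence (V0 x) (W n x)
        \<le> pmf_divergence (V n x) (W n x) + ereal \<epsilon>"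
      using V W \<open>0 < \<epsilon>\<close> by (intro pmf_divergence_limit) auto
    then show ?thesis
    proof eventually_elim
      case (elim n)
      then have "ereal (pmf p x) * pmf_divergence (V0 x) (W n x)
          \<le> ereal (pmf p x) * (pmf_divergence (V n x) (W n x) + ereal \<epsilon>)"
        by (intro ereal_mult_left_mono) auto
      then show ?case
        by (simp add: ereal_pos_distrib pmf_divergence_nonneg)
    qed
  qed
  then have "\<forall>\<^sub>F n in sequentially. \<forall>x. ereal (pmf p x) * pmf_divergence (V0 x) (W n x)
    \<le> ereal (pmf p x) * pmf_divergence (V n x) (W n x) + ereal (pmf p x * \<epsilon>)"
    by (rule eventually_all_finite)
  then show ?thesis
  proof eventually_elim
    case (elim n)
    then have "cond_divergence V0 (W n) p
      \<le> (\<Sum>x\<in>UNIV. ereal (pmf p x) * pmf_divergence (V n x) (W n x) + ereal (pmf p x * \<epsilon>))"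
      unfolding cond_divergence_def by (intro sum_mono) auto
    then show ?case
      by (simp add: sum.distrib cond_divergence_def sum_pmf_UNIV flip: sum_distrib_right)
  qed
qed

section \<open>Majorants and generalized inverses\<close>

text \<open>The supremum over \<open>s\<close> of \<open>f s - L * max 0 (s - t)\<close> is
  nondecreasing and \<open>L\<close>-Lipschitz in \<open>t\<close> and dominates \<open>f\<close>; a
  small slope makes it strict. The ramp is so steep that levels from \<open>c\<close> on are
  borrowed only from points \<open>s\<close> \<le> \<open>t + \<delta>\<close>.\<close>

lemma continuous_strict_mono_majorant:
  fixes G :: "real \<Rightarrow> ereal" and a b c A \<delta> :: real
  assumes "a \<le> b" and A: "\<And>s. s \<in> {a..b} \<Longrightarrow> G s \<le> ereal A" and "0 < \<delta>"
  obtains F :: "real \<Rightarrow> real"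
  where "continuous_on {a..b} F" "strict_mono_on {a..b} F"
    "\<forall>t\<in>{a..b}. G t \<le> ereal (F t)"
    "\<forall>t\<in>{a..b}. \<forall>u\<ge>c. u \<le> F t \<longrightarrow>
      (\<exists>s\<in>{a..b}. s \<le> t + \<delta> \<and> ereal (u - \<delta>) \<le> G s)"
proof -
  \<comment> \<open>Truncation at \<open>m\<close> makes \<open>f\<close> real where
    \<open>G\<close> is minus infinity. As \<open>m\<close> lies below \<open>c - \<delta>\<close>,
    values created by it never count as reaching a level \<open>u - \<delta>\<close> with
    \<open>u\<close> \<ge> \<open>c\<close>.\<close>
  define m where "m = min A (c - \<delta>) - 1"
  define f where "f s = real_of_ereal (max (G s) (ereal m))" for s
  \<comment> \<open>Over a distance \<delta> the ramp drops by
    \<open>\<bar>A - c\<bar> + \<delta>\<close>, at least the largest excess of \<open>f\<close>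
    over \<open>u - \<delta>\<close>.\<close>
  define L where "L = (\<bar>A - c\<bar> + \<delta>) / \<delta>"
  \<comment> \<open>The slope adds at most \<open>\<delta> / 2\<close> over the interval, leaving
    strict room for a near-maximizer \<open>s\<close>; the \<open>+ 1\<close> covers
    \<open>a = b\<close>.\<close>
  define \<epsilon> where "\<epsilon> = \<delta> / 2 / (b - a + 1)"
  have f: "ereal (f s) = max (G s) (ereal m)" if "s \<in> {a..b}" for s
    using A[OF that] by (cases "G s") (auto simp: f_def max_def)
  have fA: "f s \<le> A" if "s \<in> {a..b}" for s
  proof -
    have "ereal (f s) \<le> ereal A"
      using A[OF that] by (simp add: f[OF that] m_def)
    then show ?thesis by simp
  qed
  have L: "0 < L" using \<open>0 < \<delta>\<close> by (auto simp: L_def intro!: divide_pos_pos)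
  have \<epsilon>: "0 < \<epsilon>" using \<open>0 < \<delta>\<close> \<open>a \<le> b\<close> by (simp add: \<epsilon>_def)
  define g where "g t s = f s - L * max 0 (s - t)" for t s
  define h where "h t = (SUP s\<in>{a..b}. g t s)" for t
  define F where "F t = h t + \<epsilon> * (t - a)" for t
  have gA: "g t s \<le> A" if "s \<in> {a..b}" for s t
  proof -
    have "0 \<le> L * max 0 (s - t)" using L by simp
    with fA[OF that] show ?thesis by (simp add: g_def)
  qed
  have bdd: "bdd_above (g t ` {a..b})" for t
    using gA by (intro bdd_aboveI2)
  have ne: "{a..b} \<noteq> {}" using \<open>a \<le> b\<close> by simp
  have gh: "g t s \<le> h t" if "s \<in> {a..b}" for s t
    unfolding h_def by (intro cSUP_upper that bdd)
  have lip: "h t \<le> h t' + L * \<bar>t - t'\<bar>" for t t'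
    unfolding h_def[of t]
  proof (rule cSUP_least[OF ne])
    fix s assume s: "s \<in> {a..b}"
    have "max 0 (s - t') \<le> max 0 (s - t) + \<bar>t - t'\<bar>" by linarith
    then have "L * max 0 (s - t') \<le> L * (max 0 (s - t) + \<bar>t - t'\<bar>)"
      using L by (intro mult_left_mono) auto
    then have "g t s \<le> g t' s + L * \<bar>t - t'\<bar>"
      by (simp add: g_def distrib_left)
    with gh[OF s, of t'] show "g t s \<le> h t' + L * \<bar>t - t'\<bar>" by linarith
  qed
  have mono: "h t \<le> h t'" if "t \<le> t'" for t t'
    unfolding h_def[of t]
  proof (rule cSUP_least[OF ne])
    fix s assume s: "s \<in> {a..b}"
    have "L * max 0 (s - t') \<le> L * max 0 (s - t)"
      using L that by (intro mult_left_mono) auto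
    then have "g t s \<le> g t' s" by (simp add: g_def)
    with gh[OF s, of t'] show "g t s \<le> h t'" by linarith
  qed
  show thesis
  proof (rule that[of F])
    have "L-lipschitz_on {a..b} h"
    proof (rule lipschitz_onI)
      show "dist (h x) (h y) \<le> L * dist x y" for x y
        using lip[of x y] lip[of y x] by (simp add: dist_real_def abs_minus_commute abs_le_iff)
    qed (use L in simp)
    then have "continuous_on {a..b} h" by (rule lipschitz_on_continuous_on)
    then show "continuous_on {a..b} F"
      unfolding F_def by (intro continuous_intros)
    show "strict_mono_on {a..b} F"
    proof (rule strict_mono_onI)
      fix x y :: real assume "x < y"
      then have "\<epsilon> * (x - a) < \<epsilon> * (y - a)" using \<epsilon> by simp
      with mono[of x y] \<open>x < y\<close> show "F x < F y" by (simp add: F_def)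
    qed
    show "\<forall>t\<in>{a..b}. G t \<le> ereal (F t)"
    proof
      fix t assume t: "t \<in> {a..b}"
      have "f t \<le> h t" using gh[OF t, of t] by (simp add: g_def)
      moreover have "0 \<le> \<epsilon> * (t - a)" using \<epsilon> t by simp
      ultimately have "ereal (f t) \<le> ereal (F t)" by (simp add: F_def)
      then show "G t \<le> ereal (F t)" by (simp add: f[OF t])
    qed
    show "\<forall>t\<in>{a..b}. \<forall>u\<ge>c. u \<le> F t \<longrightarrow>
      (\<exists>s\<in>{a..b}. s \<le> t + \<delta> \<and> ereal (u - \<delta>) \<le> G s)"
    proof (intro ballI allI impI)
      fix t u assume t: "t \<in> {a..b}" and u: "c \<le> u" "u \<le> F t"
      have "\<epsilon> * (t - a) \<le> \<epsilon> * (b - a + 1)"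
        using \<epsilon> t by (intro mult_left_mono) auto
      also have "\<dots> = \<delta> / 2"
        unfolding \<epsilon>_def using \<open>a \<le> b\<close> by (intro nonzero_eq_divide_eq[THEN iffD1]) auto
      finally have "u - \<delta> < h t" using u \<open>0 < \<delta>\<close> by (simp add: F_def)
      then obtain s where s: "s \<in> {a..b}" "u - \<delta> < g t s"
        unfolding h_def by (subst (asm) less_cSUP_iff[OF ne bdd]) auto
      have "0 \<le> L * max 0 (s - t)" using L by simp
      with s have "u - \<delta> < f s" by (simp add: g_def)
      then have "ereal (u - \<delta>) < max (G s) (ereal m)" by (simp flip: f[OF s(1)])
      moreover have "m < u - \<delta>" using u by (simp add: m_def)
      ultimately have "ereal (u - \<delta>) \<le> G s" by (auto simp: less_max_iff_disj)
      moreover have "L * max 0 (s - t) < L * \<delta>"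
        using s fA[OF s(1)] u \<open>0 < \<delta>\<close> by (simp add: g_def L_def)
      then have "s \<le> t + \<delta>" using L by simp
      ultimately show "\<exists>s\<in>{a..b}. s \<le> t + \<delta> \<and> ereal (u - \<delta>) \<le> G s"
        using s by blast
    qed
  qed
qed

text \<open>Lower semicontinuity of the inverse: if \<open>c\<close> is strictly below it at
  \<open>u\<close>, then \<open>G\<close> is still below \<open>u\<close> at \<open>c\<close>, hence
  below all nearby levels, and by monotonicity so it is to the left of \<open>c\<close>.\<close>

lemma mono_inverse_lower_limit:
  fixes p :: "'x::finite pmf" and G :: "real \<Rightarrow> ereal"
  assumes mono: "\<And>s t. s \<le> t \<Longrightarrow> G s \<le> G t"
    and u: "v \<longlonglongrightarrow> u" and c: "ereal c < mono_inverse R p G u"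
  shows "\<forall>\<^sub>F n in sequentially. ereal c \<le> mono_inverse R p G (v n)"
proof (cases "min c (pmf_entropy p - R) < - R")
  case True
  then have "c < t" if "t \<in> {- R..pmf_entropy p - R}" for t
    using that by auto
  then have "ereal c \<le> mono_inverse R p G w" for w
    unfolding mono_inverse_def by (intro Inf_greatest) (auto intro: less_imp_le)
  then show ?thesis by simp
next
  case False
  \<comment> \<open>The inverse may be infinite, so \<open>c\<close> may lie beyond the right end
    and is clamped to the interval.\<close>
  define d where "d = min c (pmf_entropy p - R)"
  have d: "d \<in> {- R..pmf_entropy p - R}" using False by (auto simp: d_def)
  have "\<not> ereal u \<le> G d"
  proof
    assume "ereal u \<le> G d"
    with d have "mono_inverse R p G u \<le> ereal d"
      unfolding mono_inverse_def by (intro Inf_lower) auto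
    also have "\<dots> \<le> ereal c" by (simp add: d_def)
    finally show False using c by simp
  qed
  then have "G d < ereal u" by simp
  then have "\<forall>\<^sub>F n in sequentially. G d < ereal (v n)"
    using u by (intro order_tendstoD(1)) auto
  then show ?thesis
  proof eventually_elim
    case (elim n)
    have "ereal c \<le> ereal t" if "t \<in> {- R..pmf_entropy p - R}" "ereal (v n) \<le> G t" for t
    proof -
      have "\<not> t \<le> d"
        using mono[of t d] elim that by (auto dest: order_trans)
      with that show ?thesis by (auto simp: d_def)
    qed
    then show ?case
      unfolding mono_inverse_def by (intro Inf_greatest) auto
  qed
qed

text \<open>A larger function reaches the level \<open>u\<close> on a larger set, whose infimum is
  smaller.\<close>

lemma pos_inverse_anti:
  assumes "\<And>t. t \<in> {- R..pmf_entropy p - R} \<Longrightarrow> F t \<le> G t"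
  shows "pos_inverse R p G u \<le> pos_inverse R p F u"
proof -
  have "mono_inverse R p G u \<le> mono_inverse R p F u"
    unfolding mono_inverse_def using assms by (intro Inf_superset_mono) (auto intro: order_trans)
  then show ?thesis by (auto simp: pos_inverse_def max.coboundedI2)
qed

section \<open>Relative minima and admissibility\<close>

lemma Delta_E_r_mono:
  assumes "\<And>u. F u \<le> G u"
  shows "Delta_E_r \<gamma> F R p \<W> \<le> Delta_E_r \<gamma> G R p \<W>"
  unfolding Delta_E_r_def rel_min_def E_r_def
  by (intro INF_mono' ereal_minus_mono add_left_mono assms order_refl)

lemma le_rel_min_iff:
  "c \<le> rel_min \<gamma> E \<W> \<longleftrightarrow> (\<forall>W\<in>\<W>. c + ereal (\<gamma> W) \<le> E W)"
  by (simp add: rel_min_def le_INF_iff ereal_le_minus)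

lemma E_sp_nonneg: "0 \<le> E_sp R p W"
  unfolding E_sp_def by (intro INF_greatest cond_divergence_nonneg)

text \<open>A larger rate relaxes the constraint on \<open>V\<close>, so the sphere-packing exponent
  falls and its negative rises.\<close>

lemma F_L_star_mono:
  fixes \<W> :: "('x::finite, 'y::finite) channel set"
  assumes "s \<le> t"
  shows "F_L_star R p \<W> \<alpha> s \<le> F_L_star R p \<W> \<alpha> t"
proof -
  have "E_sp (R + t) p W \<le> E_sp (R + s) p W" for W :: "('x, 'y) channel"
    unfolding E_sp_def using assms by (intro INF_superset_mono) auto
  then show ?thesis
    unfolding F_L_star_def Delta_E_sp_def rel_min_def
    by (subst ereal_minus_le_minus) (intro INF_mono' ereal_minus_mono order_refl)
qed

text \<open>Admissibility says that \<open>\<alpha> W\<close> is at most the divergence plus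
  \<open>F (I V - R)\<close> for all pairs. As \<open>F\<close> is increasing, this amounts to the
  same bound with \<open>F t\<close> for every \<open>t\<close> with \<open>I V\<close> \<le>
  \<open>R + t\<close>, which is the sphere-packing constraint at rate \<open>R + t\<close>.\<close>

lemma F_L_iff:
  "F \<in> F_L R p \<W> \<alpha> \<longleftrightarrow> F \<in> cont_strict_mono R p \<and>
    (\<forall>t\<in>{- R..pmf_entropy p - R}. F_L_star R p \<W> \<alpha> t \<le> ereal (F t))"
proof (cases "F \<in> cont_strict_mono R p")
  case True
  define I where "I V = chan_mutual_info p V" for V :: "('a, 'b) channel"
  have I: "I V - R \<in> {- R..pmf_entropy p - R}" for V
    by (simp add: I_def chan_mutual_info_nonneg chan_mutual_info_le_entropy)
  have mono: "F s \<le> F t" if "s \<in> {- R..pmf_entropy p - R}" "t \<in> {- R..pmf_entropy p - R}" "s \<le> t" for s t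
    using True that strict_mono_on_leD[of "{- R..pmf_entropy p - R}" F]
    by (auto simp: cont_strict_mono_def)
  have "0 \<le> Delta_E_r \<alpha> (\<lambda>t. ereal (F t)) R p \<W> \<longleftrightarrow>
    (\<forall>W\<in>\<W>. \<forall>V. ereal (\<alpha> W) \<le> cond_divergence V W p + ereal (F (I V - R)))"
    by (simp add: Delta_E_r_def le_rel_min_iff E_r_def le_INF_iff I_def)
  also have "\<dots> \<longleftrightarrow> (\<forall>W\<in>\<W>. \<forall>V. ereal (\<alpha> W - F (I V - R)) \<le> cond_divergence V W p)"
  proof -
    have "ereal (\<alpha> W) \<le> cond_divergence V W p + ereal (F (I V - R)) \<longleftrightarrow>
      ereal (\<alpha> W - F (I V - R)) \<le> cond_divergence V W p" for W V
      by (cases "cond_divergence V W p") auto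
    then show ?thesis by simp
  qed
  also have "\<dots> \<longleftrightarrow> (\<forall>t\<in>{- R..pmf_entropy p - R}. \<forall>W\<in>\<W>. \<forall>V. I V \<le> R + t \<longrightarrow>
    ereal (\<alpha> W - F t) \<le> cond_divergence V W p)" (is "?L \<longleftrightarrow> ?R")
  proof
    assume ?L
    show ?R
    proof (intro ballI allI impI)
      fix t W V assume t: "t \<in> {- R..pmf_entropy p - R}" and W: "W \<in> \<W>" and V: "I V \<le> R + t"
      have "ereal (\<alpha> W - F t) \<le> ereal (\<alpha> W - F (I V - R))"
        using mono[OF I t, of V] V by simp
      also have "\<dots> \<le> cond_divergence V W p" using \<open>?L\<close> W by blast
      finally show "ereal (\<alpha> W - F t) \<le> cond_divergence V W p" .
    qed
  next
    assume ?R
    \<comment> \<open>Take \<open>t = I V - R\<close>, the smallest \<open>t\<close> allowed for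
      \<open>V\<close>.\<close>
    then show ?L using I by simp
  qed
  also have "\<dots> \<longleftrightarrow> (\<forall>t\<in>{- R..pmf_entropy p - R}. F_L_star R p \<W> \<alpha> t \<le> ereal (F t))"
    by (simp add: F_L_star_def ereal_uminus_le_reorder Delta_E_sp_def le_rel_min_iff E_sp_def
        le_INF_iff I_def)
  finally show ?thesis using True by (simp add: F_L_def)
qed (simp add: F_L_def)

text \<open>An admissible \<open>F\<close> with a large value at the right end makes the objective finite
  (take \<open>V = W\<close>), so the attainment of its minimum bounds \<open>\<beta>\<close>.\<close>

lemma beta_bounded_above:
  fixes \<W> :: "('x::finite, 'y::finite) channel set"
  assumes F: "F \<in> F_L R p \<W> \<alpha>" and R: "R \<le> pmf_entropy p"
    and H: "0 \<le> pmf_entropy p"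
    and att: "\<And>F. F \<in> F_L R p \<W> \<alpha> \<Longrightarrow>
      rel_min_attained \<beta> (E_r (pos_inverse R p (\<lambda>t. ereal (F t))) R p) \<W>"
  obtains B where "\<And>W. W \<in> \<W> \<Longrightarrow> \<beta> W \<le> B"
proof -
  define b where "b = pmf_entropy p - R"
  \<comment> \<open>Adding a nonnegative constant preserves admissibility, and this one gives
    \<open>F' b\<close> \<ge> \<open>b\<close>, so every level
    \<open>chan_mutual_info p W - R\<close> is reached at \<open>b\<close> at the latest.\<close>
  define K where "K = max 0 (b - F b)"
  define F' where "F' t = F t + K" for t
  have "F' \<in> F_L R p \<W> \<alpha>"
    using F unfolding F_L_iff cont_strict_mono_def F'_def
  proof (clarsimp, intro conjI ballI)
    assume "continuous_on {- R..pmf_entropy p - R} F"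
    then show "continuous_on {- R..pmf_entropy p - R} (\<lambda>t. F t + K)"
      by (intro continuous_intros)
  next
    assume "strict_mono_on {- R..pmf_entropy p - R} F"
    then show "strict_mono_on {- R..pmf_entropy p - R} (\<lambda>t. F t + K)"
      by (simp add: strict_mono_on_def)
  next
    fix t
    assume "\<forall>t\<in>{- R..pmf_entropy p - R}. F_L_star R p \<W> \<alpha> t \<le> ereal (F t)"
      and "t \<in> {- R..pmf_entropy p - R}"
    then have "F_L_star R p \<W> \<alpha> t \<le> ereal (F t)" by blast
    also have "\<dots> \<le> ereal (F t + K)" by (simp add: K_def)
    finally show "F_L_star R p \<W> \<alpha> t \<le> ereal (F t + K)" .
  qed
  define E :: "('x, 'y) channel \<Rightarrow> ereal"
    where "E = E_r (pos_inverse R p (\<lambda>t. ereal (F' t))) R p"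
  obtain W0 :: "('x, 'y) channel" where W0: "E W0 - ereal (\<beta> W0) = rel_min \<beta> E \<W>"
    using att[OF \<open>F' \<in> _\<close>] by (auto simp: rel_min_attained_def E_def)
  \<comment> \<open>The exponent is nonnegative, so at the attaining channel the minimum is at least
    the real number \<open>- \<beta> W0\<close>.\<close>
  have "0 \<le> E W0"
    by (auto simp: E_def E_r_def pos_inverse_def intro!: INF_greatest add_nonneg_nonneg cond_divergence_nonneg)
  then have "ereal (- \<beta> W0) \<le> rel_min \<beta> E \<W>"
    unfolding W0[symmetric] by (cases "E W0") auto
  then have lower: "ereal (- \<beta> W0) + ereal (\<beta> W) \<le> E W" if "W \<in> \<W>" for W
    using that \<open>ereal (- \<beta> W0) \<le> rel_min \<beta> E \<W>\<close> by (simp add: le_rel_min_iff)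
  have upper: "E W \<le> ereal b" for W
  proof -
    have "chan_mutual_info p W - R \<le> F' b"
      using chan_mutual_info_le_entropy[of p W] by (simp add: F'_def K_def b_def)
    then have "mono_inverse R p (\<lambda>t. ereal (F' t)) (chan_mutual_info p W - R) \<le> ereal b"
      unfolding mono_inverse_def using H by (intro Inf_lower) (auto simp: b_def)
    then have "pos_inverse R p (\<lambda>t. ereal (F' t)) (chan_mutual_info p W - R) \<le> ereal b"
      using R by (simp add: pos_inverse_def b_def)
    moreover have "E W \<le> cond_divergence W W p
        + pos_inverse R p (\<lambda>t. ereal (F' t)) (chan_mutual_info p W - R)"
      unfolding E_def E_r_def by (rule INF_lower) simp
    ultimately show ?thesis
      by (simp add: cond_divergence_self)
  qed
  show thesis
  proof (rule that)
    fix W assume "W \<in> \<W>"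
    have "ereal (- \<beta> W0) + ereal (\<beta> W) \<le> ereal b"
      using lower[OF \<open>W \<in> \<W>\<close>] upper[of W] by (rule order_trans)
    then show "\<beta> W \<le> b + \<beta> W0" by simp
  qed
qed

section \<open>The supremum for a fixed input distribution\<close>

lemma sup_F_L_eq:
  fixes \<W> :: "('x::finite, 'y::finite) channel set"
  assumes R: "R \<le> pmf_entropy p" and H: "0 \<le> pmf_entropy p"
    and att_sp: "rel_min_attained \<alpha> (E_sp (pmf_entropy p) p) \<W>"
    and att: "\<And>F. F \<in> F_L R p \<W> \<alpha> \<Longrightarrow>
      rel_min_attained \<beta> (E_r (pos_inverse R p (\<lambda>t. ereal (F t))) R p) \<W>"
  shows "sup_F_L R p \<W> \<alpha> \<beta> = Delta_E_r \<beta> (pos_inverse R p (F_L_star R p \<W> \<alpha>)) R p \<W>"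
proof (rule antisym)
  show "sup_F_L R p \<W> \<alpha> \<beta> \<le> Delta_E_r \<beta> (pos_inverse R p (F_L_star R p \<W> \<alpha>)) R p \<W>"
    unfolding sup_F_L_def by (intro SUP_least Delta_E_r_mono pos_inverse_anti) (auto simp: F_L_iff)
  define G where "G = F_L_star R p \<W> \<alpha>"
  define b where "b = pmf_entropy p - R"
  have "- R \<le> b" using H by (simp add: b_def)
  have G_mono: "G s \<le> G t" if "s \<le> t" for s t
    using F_L_star_mono[OF that] by (simp add: G_def)
  obtain W0 where W0: "E_sp (pmf_entropy p) p W0 - ereal (\<alpha> W0) = Delta_E_sp \<alpha> (pmf_entropy p) p \<W>"
    using att_sp by (auto simp: rel_min_attained_def Delta_E_sp_def)
  \<comment> \<open>Attainment at the top rate supplies the real upper bound on \<open>G\<close>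
    that the majorant construction requires.\<close>
  have "G b \<le> ereal (\<alpha> W0)"
    unfolding G_def F_L_star_def b_def using E_sp_nonneg[of "pmf_entropy p" p W0]
    by (cases "E_sp (pmf_entropy p) p W0") (simp_all flip: W0)
  then have G_le: "G t \<le> ereal (\<alpha> W0)" if "t \<in> {- R..b}" for t
    using that G_mono[of t b] by (auto intro: order_trans)
  \<comment> \<open>Levels have the form \<open>I V\<close> \<ge> \<open>- R\<close>; there the two
    inverses compare up to a shift \<delta> in argument and in value.\<close>
  have majorant: "\<exists>F\<in>F_L R p \<W> \<alpha>. \<forall>u\<ge>- R.
      mono_inverse R p G (u - \<delta>) \<le> mono_inverse R p (\<lambda>t. ereal (F t)) u + ereal \<delta>"
    if "0 < \<delta>" for \<delta>
  proof -
    obtain F where F: "continuous_on {- R..b} F" "strict_mono_on {- R..b} F"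
      "\<forall>t\<in>{- R..b}. G t \<le> ereal (F t)"
      "\<forall>t\<in>{- R..b}. \<forall>u\<ge>- R. u \<le> F t \<longrightarrow>
        (\<exists>s\<in>{- R..b}. s \<le> t + \<delta> \<and> ereal (u - \<delta>) \<le> G s)"
      using continuous_strict_mono_majorant[OF \<open>- R \<le> b\<close> G_le \<open>0 < \<delta>\<close>, where c = "- R"] .
    have "mono_inverse R p G (u - \<delta>) \<le> mono_inverse R p (\<lambda>t. ereal (F t)) u + ereal \<delta>"
      if u: "- R \<le> u" for u
    proof -
      have "mono_inverse R p G (u - \<delta>) - ereal \<delta> \<le> ereal t"
        if t: "t \<in> {- R..b}" "u \<le> F t" for t
      proof -
        obtain s where s: "s \<in> {- R..b}" "s \<le> t + \<delta>" "ereal (u - \<delta>) \<le> G s"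
          using F(4) t u by blast
        then have "mono_inverse R p G (u - \<delta>) \<le> ereal s"
          unfolding mono_inverse_def b_def by (intro Inf_lower) auto
        also have "\<dots> \<le> ereal t + ereal \<delta>" using s by simp
        finally show ?thesis by (simp add: ereal_minus_le)
      qed
      then have "mono_inverse R p G (u - \<delta>) - ereal \<delta> \<le> mono_inverse R p (\<lambda>t. ereal (F t)) u"
        unfolding mono_inverse_def[of R p "\<lambda>t. ereal (F t)"]
        by (intro Inf_greatest) (auto simp: b_def)
      then show ?thesis by (simp add: ereal_minus_le)
    qed
    moreover have "F \<in> F_L R p \<W> \<alpha>"
      using F(1-3) by (simp add: F_L_iff cont_strict_mono_def G_def b_def)
    ultimately show ?thesis by blast
  qed
  \<comment> \<open>Any majorant will do here; it only witnesses that an admissible function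
    exists.\<close>
  obtain B where B: "\<And>W. W \<in> \<W> \<Longrightarrow> \<beta> W \<le> B"
    using majorant[of 1] beta_bounded_above[OF _ R H att] by auto
  show "Delta_E_r \<beta> (pos_inverse R p G) R p \<W> \<le> sup_F_L R p \<W> \<alpha> \<beta>"
  proof (rule ccontr)
    assume "\<not> ?thesis"
    then obtain c1 where c1: "sup_F_L R p \<W> \<alpha> \<beta> < ereal c1"
      "ereal c1 < Delta_E_r \<beta> (pos_inverse R p G) R p \<W>"
      using ereal_dense2[of "sup_F_L R p \<W> \<alpha> \<beta>"] by (auto simp: not_le)
    then obtain c2 where c2: "c1 < c2" "ereal c2 < Delta_E_r \<beta> (pos_inverse R p G) R p \<W>"
      using ereal_dense2[OF c1(2)] by auto
    define \<eta> where "\<eta> = (c2 - c1) / 2"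
    have \<eta>: "0 < \<eta>" "c2 = c1 + 2 * \<eta>" using c2 by (auto simp: \<eta>_def field_simps)
    define I where "I V = chan_mutual_info p V - R" for V :: "('x, 'y) channel"
    have I: "- R \<le> I V" for V by (simp add: I_def chan_mutual_info_nonneg)
    define \<delta> where "\<delta> n = inverse (real (Suc n))" for n
    \<comment> \<open>The supremum is below \<open>c1\<close>, so the \<open>n\<close>-th majorant
      has a pair \<open>V\<close>, \<open>W\<close> whose objective stays below
      \<open>c1 + \<beta> W\<close>.\<close>
    have "\<exists>F V W. W \<in> \<W> \<and>
        (\<forall>u\<ge>- R. mono_inverse R p G (u - \<delta> n) \<le> mono_inverse R p (\<lambda>t. ereal (F t)) u + ereal (\<delta> n)) \<and>
        cond_divergence V W p + pos_inverse R p (\<lambda>t. ereal (F t)) (I V) < ereal (c1 + \<beta> W)" for n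
    proof -
      obtain F where F: "F \<in> F_L R p \<W> \<alpha>"
        "\<forall>u\<ge>- R. mono_inverse R p G (u - \<delta> n) \<le> mono_inverse R p (\<lambda>t. ereal (F t)) u + ereal (\<delta> n)"
        using majorant[of "\<delta> n"] by (auto simp: \<delta>_def)
      have "Delta_E_r \<beta> (pos_inverse R p (\<lambda>t. ereal (F t))) R p \<W> \<le> sup_F_L R p \<W> \<alpha> \<beta>"
        unfolding sup_F_L_def using F(1) by (rule SUP_upper)
      also note c1(1)
      finally have "\<not> ereal c1 \<le> Delta_E_r \<beta> (pos_inverse R p (\<lambda>t. ereal (F t))) R p \<W>"
        by simp
      then show ?thesis
        using F(2) by (auto simp: Delta_E_r_def le_rel_min_iff E_r_def le_INF_iff not_le I_def)
    qed
    then obtain F V W where FVW: "\<And>n. W n \<in> \<W>"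
      "\<And>n u. - R \<le> u \<Longrightarrow> mono_inverse R p G (u - \<delta> n)
        \<le> mono_inverse R p (\<lambda>t. ereal (F n t)) u + ereal (\<delta> n)"
      "\<And>n. cond_divergence (V n) (W n) p + pos_inverse R p (\<lambda>t. ereal (F n t)) (I (V n))
        < ereal (c1 + \<beta> (W n))"
      by metis
    obtain r1 V0 where r1: "strict_mono r1" "\<forall>x y. (\<lambda>n. pmf (V (r1 n) x) y) \<longlonglongrightarrow> pmf (V0 x) y"
      using channel_convergent_subseq[of V] .
    \<comment> \<open>The limit \<open>W1\<close> may lie outside \<W>; it serves only the
      semicontinuity of the divergence.\<close>
    obtain r2 W1 where r2: "strict_mono r2"
      "\<forall>x y. (\<lambda>n. pmf (W (r1 (r2 n)) x) y) \<longlonglongrightarrow> pmf (W1 x) y"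
      using channel_convergent_subseq[of "\<lambda>n. W (r1 n)"] .
    define r where "r n = r1 (r2 n)" for n
    have r: "strict_mono r" using r1(1) r2(1) by (simp add: r_def strict_mono_def)
    have V: "(\<lambda>n. pmf (V (r n) x) y) \<longlonglongrightarrow> pmf (V0 x) y" for x y
      using LIMSEQ_subseq_LIMSEQ[OF r1(2)[rule_format] r2(1)] by (simp add: r_def o_def)
    have W: "(\<lambda>n. pmf (W (r n) x) y) \<longlonglongrightarrow> pmf (W1 x) y" for x y
      using r2(2) by (simp add: r_def)
    have \<delta>: "(\<lambda>n. \<delta> (r n)) \<longlonglongrightarrow> 0"
      using LIMSEQ_subseq_LIMSEQ[OF LIMSEQ_inverse_real_of_nat r] by (simp add: \<delta>_def o_def)
    define D where "D n = real_of_ereal (cond_divergence (V n) (W n) p)" for n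
    define P where "P n = real_of_ereal (pos_inverse R p (\<lambda>t. ereal (F n t)) (I (V n)))" for n
    have DP: "cond_divergence (V n) (W n) p = ereal (D n)"
      "pos_inverse R p (\<lambda>t. ereal (F n t)) (I (V n)) = ereal (P n)"
      "0 \<le> D n" "0 \<le> P n" "D n + P n < c1 + \<beta> (W n)" for n
    proof -
      have nonneg: "0 \<le> cond_divergence (V n) (W n) p"
        "0 \<le> pos_inverse R p (\<lambda>t. ereal (F n t)) (I (V n))"
        by (simp_all add: cond_divergence_nonneg pos_inverse_def)
      with FVW(3)[of n] show eq: "cond_divergence (V n) (W n) p = ereal (D n)"
        "pos_inverse R p (\<lambda>t. ereal (F n t)) (I (V n)) = ereal (P n)"
        by (cases "cond_divergence (V n) (W n) p";
            cases "pos_inverse R p (\<lambda>t. ereal (F n t)) (I (V n))"; simp add: D_def P_def)+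
      from nonneg FVW(3)[of n] show "0 \<le> D n" "0 \<le> P n" "D n + P n < c1 + \<beta> (W n)"
        unfolding eq by simp_all
    qed
    have bound: "D n + P n \<le> c1 + B" for n
      using DP(5)[of n] B[OF FVW(1)[of n]] by linarith
    have "\<forall>\<^sub>F n in sequentially. cond_divergence V0 (W (r n)) p \<le> cond_divergence (V (r n)) (W (r n)) p + ereal (\<eta> / 2)"
    proof (rule cond_divergence_limit[OF V W])
      show "cond_divergence (V (r n)) (W (r n)) p \<le> ereal (c1 + B)" for n
        using bound[of "r n"] DP(4)[of "r n"] by (simp add: DP(1))
    qed (use \<eta> in simp)
    then have lower: "\<forall>\<^sub>F n in sequentially. ereal (P (r n) + \<eta>) \<le> pos_inverse R p G (I V0)"
    proof eventually_elim
      case (elim n)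
      \<comment> \<open>The mixed pair \<open>V0\<close>, \<open>W (r n)\<close> competes in the
        claimed minimum, which exceeds \<open>c2\<close>. Of the gap \<open>2 * \<eta>\<close>, half
        of \<eta> pays for replacing \<open>V (r n)\<close> by \<open>V0\<close>.\<close>
      have "ereal c2 + ereal (\<beta> (W (r n))) \<le> cond_divergence V0 (W (r n)) p + pos_inverse R p G (I V0)"
        using c2(2) FVW(1)[of "r n"] less_imp_le
        by (fastforce simp: Delta_E_r_def le_rel_min_iff E_r_def le_INF_iff I_def)
      also have "\<dots> \<le> ereal (D (r n) + \<eta> / 2) + pos_inverse R p G (I V0)"
        using elim by (intro add_right_mono) (simp add: DP(1))
      finally show ?case
        using DP(5)[of "r n"] \<eta> by (cases "pos_inverse R p G (I V0)") auto
    qed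
    \<comment> \<open>A real \<open>c\<close> strictly below the limiting inverse yet above all late
      \<open>P (r n)\<close> by a fixed margin; if that inverse is infinite,
      \<open>c1 + B + 1\<close> exceeds the uniform bound on \<open>P\<close> by 1.\<close>
    define c where "c = (if pos_inverse R p G (I V0) = \<infinity> then c1 + B + 1
      else real_of_ereal (pos_inverse R p G (I V0)) - \<eta> / 2)"
    have "0 \<le> pos_inverse R p G (I V0)" by (simp add: pos_inverse_def)
    then have c: "ereal c < pos_inverse R p G (I V0)"
      using \<eta> by (cases "pos_inverse R p G (I V0)") (auto simp: c_def)
    have gap: "\<forall>\<^sub>F n in sequentially. P (r n) + min 1 (\<eta> / 2) \<le> c"
      using lower
    proof eventually_elim
      case (elim n)
      show ?case
      proof (cases "pos_inverse R p G (I V0)")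
        case (real x)
        then show ?thesis using elim \<eta> by (simp add: c_def)
      next
        case PInf
        then show ?thesis using bound[of "r n"] DP(3)[of "r n"] by (simp add: c_def)
      qed (use \<open>0 \<le> pos_inverse R p G (I V0)\<close> in simp)
    qed
    have "(\<lambda>n. I (V (r n)) - \<delta> (r n)) \<longlonglongrightarrow> I V0 - 0"
      unfolding I_def by (intro tendsto_intros chan_mutual_info_tendsto V \<delta>)
    then have lim: "(\<lambda>n. I (V (r n)) - \<delta> (r n)) \<longlonglongrightarrow> I V0" by simp
    have "\<forall>\<^sub>F n in sequentially. ereal c \<le> pos_inverse R p G (I (V (r n)) - \<delta> (r n))"
    \<comment> \<open>Semicontinuity is known for the inverse before the positive part is taken; for
      \<open>c\<close> \<le> 0 the positive part alone suffices.\<close>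
    proof (cases "c \<le> 0")
      case True
      then show ?thesis by (simp add: pos_inverse_def le_max_iff_disj)
    next
      case False
      then have "ereal c < mono_inverse R p G (I V0)"
        using c by (auto simp: pos_inverse_def less_max_iff_disj)
      with G_mono lim
      have "\<forall>\<^sub>F n in sequentially. ereal c \<le> mono_inverse R p G (I (V (r n)) - \<delta> (r n))"
        by (rule mono_inverse_lower_limit)
      then show ?thesis
        by eventually_elim (simp add: pos_inverse_def le_max_iff_disj)
    qed
    moreover have "\<forall>\<^sub>F n in sequentially. \<delta> (r n) < min 1 (\<eta> / 2)"
      using \<delta> \<eta> by (intro order_tendstoD(2)) auto
    \<comment> \<open>Semicontinuity gives \<open>c\<close> \<le>
      \<open>P (r n) + \<delta> (r n)\<close>, while the shift is eventually smaller than the margin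
      between \<open>P (r n)\<close> and \<open>c\<close>.\<close>
    ultimately have "\<forall>\<^sub>F n in sequentially. False"
      using gap
    proof eventually_elim
      case (elim n)
      let ?m = "mono_inverse R p (\<lambda>t. ereal (F (r n) t)) (I (V (r n)))"
      have "ereal c \<le> pos_inverse R p G (I (V (r n)) - \<delta> (r n))" by (rule elim)
      also have "\<dots> \<le> max 0 (?m + ereal (\<delta> (r n)))"
        unfolding pos_inverse_def using FVW(2)[OF I] by (intro max.mono) auto
      also have "\<dots> \<le> max 0 ?m + ereal (\<delta> (r n))"
        by (auto intro!: add_right_mono add_nonneg_nonneg simp: \<delta>_def)
      also have "max 0 ?m = ereal (P (r n))"
        using DP(2)[of "r n"] by (simp add: pos_inverse_def)
      finally show False using elim by simp
    qed
    then show False by simp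
  qed
qed

section \<open>From each input distribution to the relative minimax\<close>

theorem proposition6p1:
  fixes R :: real
    and \<W> :: "('x::finite, 'y::finite) channel set"
    and \<alpha> \<beta> :: "('x, 'y) channel \<Rightarrow> real"
  assumes "0 < R"
    and "\<W> \<noteq> {}"
    and "connected (channel_matrix ` \<W>)"
    and "minima_attained R \<W> \<alpha> \<beta>"
  shows "(\<forall>p\<in>inputs R.
            (Delta_E_sp \<alpha> R p \<W> < \<infinity> \<longrightarrow>
               (\<forall>t\<in>{-R..pmf_entropy p - R}.
                  F_L_star R p \<W> \<alpha> t = F_rel R p \<W> \<alpha> t - Delta_E_sp \<alpha> R p \<W>)) \<and>
            sup_F_L R p \<W> \<alpha> \<beta>
              = Delta_E_r \<beta> (pos_inverse R p (F_L_star R p \<W> \<alpha>)) R p \<W>) \<and>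
         rel_minimax R \<W> \<alpha> \<beta>
           = (SUP p\<in>inputs R. Delta_E_r \<beta> (pos_inverse R p (F_L_star R p \<W> \<alpha>)) R p \<W>) \<and>
         (\<forall>p\<in>inputs R.
            sup_F_L R p \<W> \<alpha> \<beta> = rel_minimax R \<W> \<alpha> \<beta> \<longleftrightarrow>
            Delta_E_r \<beta> (pos_inverse R p (F_L_star R p \<W> \<alpha>)) R p \<W> = rel_minimax R \<W> \<alpha> \<beta>)"
proof -
  have eq: "sup_F_L R p \<W> \<alpha> \<beta> = Delta_E_r \<beta> (pos_inverse R p (F_L_star R p \<W> \<alpha>)) R p \<W>"
    if p: "p \<in> inputs R" for p
  proof (rule sup_F_L_eq)
    show R: "R \<le> pmf_entropy p" using p by (simp add: inputs_def)
    with \<open>0 < R\<close> show "0 \<le> pmf_entropy p" by simp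
    then have "pmf_entropy p - R \<in> {- R..pmf_entropy p - R}" by simp
    then have "rel_min_attained \<alpha> (E_sp (R + (pmf_entropy p - R)) p) \<W>"
      using assms(4) p unfolding minima_attained_def by blast
    then show "rel_min_attained \<alpha> (E_sp (pmf_entropy p) p) \<W>" by simp
  qed (use assms(4) p in \<open>auto simp: minima_attained_def\<close>)
  have "F_L_star R p \<W> \<alpha> t = F_rel R p \<W> \<alpha> t - Delta_E_sp \<alpha> R p \<W>"
    if p: "p \<in> inputs R" and fin: "Delta_E_sp \<alpha> R p \<W> < \<infinity>" for p t
  proof -
    have "0 \<in> {- R..pmf_entropy p - R}" using p \<open>0 < R\<close> by (simp add: inputs_def)
    then have "rel_min_attained \<alpha> (E_sp (R + 0) p) \<W>"
      using assms(4) p unfolding minima_attained_def by blast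
    then obtain W where W: "E_sp R p W - ereal (\<alpha> W) = Delta_E_sp \<alpha> R p \<W>"
      by (auto simp: rel_min_attained_def Delta_E_sp_def)
    \<comment> \<open>Minus infinity is excluded by nonnegativity of the attained exponent, so the
      value is real and cancels in the extended difference.\<close>
    obtain d where d: "Delta_E_sp \<alpha> R p \<W> = ereal d"
      using fin E_sp_nonneg[of R p W] by (cases "E_sp R p W") (auto simp flip: W)
    show ?thesis
      by (cases "Delta_E_sp \<alpha> (R + t) p \<W>") (simp_all add: F_L_star_def F_rel_def d)
  qed
  then show ?thesis
    by (simp add: eq rel_minimax_def cong: SUP_cong)
qed

end
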